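(* Let $\mathbf{n}=(n_1,\ldots,n_d)\in\mathbb{N}^d$ have pairwise relatively prime entries. We have $\mathcal{C}^{(\mathbf{n})}=\ell^{(\mathbf{n})}_{\mathbf{0},\mathbf{1}}([0,2\pi))=\ell^{(\mathbf{n})}_{\mathbf{0},\mathbf{1}}([0,\pi])$. A point $\mathbf{x}\in\mathcal{C}^{(\mathbf{n})}$ is a singular point of $\mathcal{C}^{(\mathbf{n})}$ if and only if it is an element of $\mathrm{LC}^{(\mathbf{n})}_M$ for some $M\subseteq\{1,\ldots,d\}$ with $\#M\geq 2$. Furthermore, for all $M\subseteq\{1,\ldots,d\}$ and $\mathfrak{r}\in\{0,1\}$ we have $$\mathrm{LC}^{(\mathbf{n})}_{M,\mathfrak{r}}=\bigl\{\mathbf{x}\in F^d_M\ \big|\ T_{n_1}(x_1)=\cdots=T_{n_d}(x_d)=(-1)^{\mathfrak{r}}\bigr\}.$$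
   Context: $\mathbb{N}=\{1,2,\ldots\}$, $\mathbb{N}_0=\mathbb{N}\cup\{0\}$, $d\in\mathbb{N}$. $T_\gamma(x)=\cos(\gamma\arccos x)$, $x\in[-1,1]$, are the univariate Chebyshev polynomials of the first kind. The Chebyshev variety is $\mathcal{C}^{(\mathbf{n})}=\{\mathbf{x}\in[-1,1]^d\mid T_{n_1}(x_1)=\cdots=T_{n_d}(x_d)\}$. A point $\mathbf{x}^*\in\mathcal{C}^{(\mathbf{n})}$ is called singular if the Jacobian matrix at $\mathbf{x}^*$ of $(f_1,\ldots,f_{d-1})$, where $f_i(\mathbf{x})=T_{n_i}(x_i)-T_{n_{i+1}}(x_{i+1})$, does not have full rank $d-1$. With $p_i[\mathbf{n}]=\prod_{j\ne i}n_j$, the curve is $\ell^{(\mathbf{n})}_{\mathbf{0},\mathbf{1}}(t)=(\cos(p_1[\mathbf{n}]t),\ldots,\cos(p_d[\mathbf{n}]t))$. For $\mathfrak{r}\in\{0,1\}$ let $I^{(\mathbf{n})}_{\mathfrak{r}}$ be the set of all $\mathbf{i}\in\mathbb{N}_0^d$ with $0\le i_j\le n_j$ and $i_j\equiv\mathfrak{r}\bmod 2$ for all $j$. For $M\subseteq\{1,\ldots,d\}$ let $I^{(\mathbf{n})}_{M,\mathfrak{r}}$ be the set of those $\mathbf{i}\in I^{(\mathbf{n})}_{\mathfrak{r}}$ such that for each $j$: $0<i_j<n_j\Leftrightarrow j\in M$. Let $\mathbf{z}^{(\mathbf{n})}_{\mathbf{i}}=(\cos(i_1\pi/n_1),\ldots,\cos(i_d\pi/n_d))$,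 $\mathrm{LC}^{(\mathbf{n})}_{M,\mathfrak{r}}=\{\mathbf{z}^{(\mathbf{n})}_{\mathbf{i}}\mid\mathbf{i}\in I^{(\mathbf{n})}_{M,\mathfrak{r}}\}$ and $\mathrm{LC}^{(\mathbf{n})}_M=\mathrm{LC}^{(\mathbf{n})}_{M,0}\cup\mathrm{LC}^{(\mathbf{n})}_{M,1}$. $F^d_M$ is the set of all $\mathbf{x}\in[-1,1]^d$ with $x_i\in(-1,1)$ for $i\in M$ and $x_i\in\{-1,1\}$ for $i\notin M$. *)

theory Defs
  imports
    "HOL-Analysis.Derivative"
    "HOL-Computational_Algebra.Polynomial"
    "HOL-Number_Theory.Cong"
    "Jordan_Normal_Form.DL_Rank"
begin

text \<open>Points of real \<open>d\<close>-space and multi-indices are vectors of dimension \<open>d\<close>; coordinates are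
  numbered from \<open>0\<close> to \<open>d - 1\<close>. The dimension \<open>d\<close> is always that of the tuple \<open>n\<close>.\<close>

text \<open>The Chebyshev polynomial is taken as a polynomial, so that it is differentiable at the
  boundary points \<open>-1\<close> and \<open>1\<close> as well. The description operator is justified by
  \<open>chebyshev_poly_ex1\<close> below.\<close>

definition chebyshev_poly :: "nat \<Rightarrow> real poly" where
  "chebyshev_poly k = (THE p. \<forall>x\<in>{-1..1}. poly p x = cos (real k * arccos x))"

lemma chebyshev_poly_exists:
  "\<exists>p :: real poly. \<forall>x\<in>{-1..1}. poly p x = cos (real k * arccos x)"
proof (induction k rule: less_induct)
  case (less k)
  consider "k = 0" | "k = 1" | m where "k = Suc (Suc m)"
    by (metis One_nat_def not0_implies_Suc)
  then show ?case
  proof cases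
    case 1
    then show ?thesis by (intro exI[of _ 1]) auto
  next
    case 2
    then show ?thesis by (intro exI[of _ "[:0, 1:]"]) auto
  next
    case (3 m)
    obtain p :: "real poly" where p: "\<forall>x\<in>{-1..1}. poly p x = cos (real m * arccos x)"
      using less[of m] 3 by auto
    obtain q :: "real poly" where q: "\<forall>x\<in>{-1..1}. poly q x = cos (real (Suc m) * arccos x)"
      using less[of "Suc m"] 3 by auto
    have "poly ([:0, 2:] * q - p) x = cos (real k * arccos x)" if x: "x \<in> {-1..1}" for x
    proof -
      define t where "t = arccos x"
      have ct: "cos t = x" using x by (simp add: t_def)
      have "2 * (cos (real (Suc m) * t) * cos t)
          = cos (real (Suc m) * t - t) + cos (real (Suc m) * t + t)"
        by (simp add: cos_times_cos)
      moreover have "real (Suc m) * t - t = real m * t" "real (Suc m) * t + t = real k * t"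
        using 3 by (simp_all add: algebra_simps)
      ultimately have "cos (real k * t) = 2 * (cos (real (Suc m) * t) * x) - cos (real m * t)"
        using ct by simp
      then show ?thesis using p q x by (simp add: t_def)
    qed
    then show ?thesis by blast
  qed
qed

lemma chebyshev_poly_ex1:
  "\<exists>!p :: real poly. \<forall>x\<in>{-1..1}. poly p x = cos (real k * arccos x)"
proof (rule ex_ex1I[OF chebyshev_poly_exists])
  fix p q :: "real poly"
  assume "\<forall>x\<in>{-1..1}. poly p x = cos (real k * arccos x)"
    and "\<forall>x\<in>{-1..1}. poly q x = cos (real k * arccos x)"
  then have "{-1..1} \<subseteq> {x. poly (p - q) x = 0}" by auto
  moreover have "infinite {-1..1::real}" by (simp add: infinite_Icc)
  ultimately show "p = q"
    using poly_roots_finite[of "p - q"] by (metis eq_iff_diff_eq_0 finite_subset)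
qed

lemma poly_chebyshev_poly:
  "x \<in> {-1..1} \<Longrightarrow> poly (chebyshev_poly k) x = cos (real k * arccos x)"
  using theI'[OF chebyshev_poly_ex1[of k]] unfolding chebyshev_poly_def by blast

definition unit_cube :: "nat \<Rightarrow> real vec set" where
  "unit_cube d = {x \<in> carrier_vec d. \<forall>i<d. x $ i \<in> {-1..1}}"

definition chebyshev_variety :: "nat vec \<Rightarrow> real vec set" where
  "chebyshev_variety n = {x \<in> unit_cube (dim_vec n).
     \<forall>i<dim_vec n. \<forall>j<dim_vec n.
       poly (chebyshev_poly (n $ i)) (x $ i) = poly (chebyshev_poly (n $ j)) (x $ j)}"

definition partial_deriv :: "(real vec \<Rightarrow> real) \<Rightarrow> nat \<Rightarrow> real vec \<Rightarrow> real" where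
  "partial_deriv f j x = deriv (\<lambda>t. f (x |\<^sub>v j \<mapsto> t)) (x $ j)"

definition jacobian_mat :: "nat \<Rightarrow> (nat \<Rightarrow> real vec \<Rightarrow> real) \<Rightarrow> real vec \<Rightarrow> real mat" where
  "jacobian_mat m f x = mat m (dim_vec x) (\<lambda>(i, j). partial_deriv (f i) j x)"

definition chebyshev_eqn :: "nat vec \<Rightarrow> nat \<Rightarrow> real vec \<Rightarrow> real" where
  "chebyshev_eqn n i x =
     poly (chebyshev_poly (n $ i)) (x $ i) - poly (chebyshev_poly (n $ Suc i)) (x $ Suc i)"

text \<open>The first argument of \<open>vec_space.rank\<close> is the number of rows.\<close>

definition singular_point :: "nat vec \<Rightarrow> real vec \<Rightarrow> bool" where
  "singular_point n x \<longleftrightarrow> x \<in> chebyshev_variety n \<and>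
     vec_space.rank (dim_vec n - 1) (jacobian_mat (dim_vec n - 1) (chebyshev_eqn n) x)
       \<noteq> dim_vec n - 1"

definition lissajous_curve :: "nat vec \<Rightarrow> real \<Rightarrow> real vec" where
  "lissajous_curve n t =
     vec (dim_vec n) (\<lambda>i. cos (real (\<Prod>j\<in>{..<dim_vec n} - {i}. n $ j) * t))"

definition index_set :: "nat vec \<Rightarrow> nat \<Rightarrow> nat vec set" where
  "index_set n r =
     {i \<in> carrier_vec (dim_vec n). \<forall>j<dim_vec n. i $ j \<le> n $ j \<and> [i $ j = r] (mod 2)}"

definition index_set_on :: "nat vec \<Rightarrow> nat set \<Rightarrow> nat \<Rightarrow> nat vec set" where
  "index_set_on n M r =
     {i \<in> index_set n r. \<forall>j<dim_vec n. (0 < i $ j \<and> i $ j < n $ j) \<longleftrightarrow> j \<in> M}"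

definition z_point :: "nat vec \<Rightarrow> nat vec \<Rightarrow> real vec" where
  "z_point n i = vec (dim_vec n) (\<lambda>j. cos (real (i $ j) * pi / real (n $ j)))"

definition LC_parity :: "nat vec \<Rightarrow> nat set \<Rightarrow> nat \<Rightarrow> real vec set" where
  "LC_parity n M r = z_point n ` index_set_on n M r"

definition LC :: "nat vec \<Rightarrow> nat set \<Rightarrow> real vec set" where
  "LC n M = LC_parity n M 0 \<union> LC_parity n M 1"

definition cube_face :: "nat \<Rightarrow> nat set \<Rightarrow> real vec set" where
  "cube_face d M = {x \<in> unit_cube d.
     (\<forall>i<d. i \<in> M \<longrightarrow> x $ i \<in> {-1<..<1}) \<and> (\<forall>i<d. i \<notin> M \<longrightarrow> x $ i \<in> {-1, 1})}"

end

theory Submission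
  imports Defs
begin

text \<open>If \<open>T\<^sub>n\<^sub>i(x\<^sub>i) = cos \<tau>\<close> for all \<open>i\<close>, then \<open>x\<^sub>i = cos ((\<tau> + 2 \<pi> k\<^sub>i) / n\<^sub>i)\<close> for integers \<open>k\<^sub>i\<close>, and
  the Chinese remainder theorem replaces the \<open>k\<^sub>i\<close> by a single \<open>m\<close>; then \<open>x\<close> is the point of the
  curve with parameter \<open>(\<tau> + 2 \<pi> m) / (n\<^sub>1 \<cdots> n\<^sub>d)\<close>. As \<open>cos (p t)\<close> is a polynomial in \<open>cos t\<close>, the
  parameters in \<open>[0, \<pi>]\<close> suffice.

  The Jacobian is bidiagonal with entries \<open>\<plusminus> T\<^sub>n\<^sub>j'(x\<^sub>j)\<close> in column \<open>j\<close>, so it loses rank exactly when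
  two of these derivatives vanish. The zeros of \<open>T\<^sub>n'\<close> in \<open>[-1, 1]\<close> are the interior points where
  \<open>T\<^sub>n = \<plusminus> 1\<close>. On the variety this value is common to all coordinates, so a singular point lies on a
  set \<open>LC\<^sub>M\<close>, where \<open>M\<close> collects its interior coordinates.\<close>

unbundle no vec_syntax

section \<open>Values, derivatives and extrema of Chebyshev polynomials on [-1, 1]\<close>

lemma cos_eq_cosD:
  fixes x y :: real
  assumes "cos x = cos y"
  shows "\<exists>k::int. x = y + 2 * pi * k \<or> x = - y + 2 * pi * k"
proof -
  have "sin ((x + y) / 2) * sin ((y - x) / 2) = 0"
    using assms cos_diff_cos[of x y] by simp
  then consider "sin ((x + y) / 2) = 0" | "sin ((y - x) / 2) = 0" by auto
  then show ?thesis
  proof cases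
    case 1
    then obtain k :: int where "(x + y) / 2 = k * pi" by (auto simp: sin_zero_iff_int2)
    then have "x = - y + 2 * pi * k" by (simp add: field_simps)
    then show ?thesis by blast
  next
    case 2
    then obtain k :: int where "(y - x) / 2 = k * pi" by (auto simp: sin_zero_iff_int2)
    then have "x = y + 2 * pi * (- k :: int)" by (simp add: field_simps)
    then show ?thesis by blast
  qed
qed

lemma abs_cos_eq_1_iff: "\<bar>cos u\<bar> = 1 \<longleftrightarrow> sin u = 0" for u :: real
  by (simp flip: abs_square_eq_1 add: cos_squared_eq)

lemma cos_add_2pi_int: "cos (x + 2 * pi * of_int k) = cos x" for x :: real
  using cos_int_2pin[of k] sin_int_2pin[of k] by (simp add: cos_add)

text \<open>\<open>arccos (cos t)\<close> is t or -t up to a multiple of 2 pi, and multiplication by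
  the natural number k preserves this form. So the defining formula extends from angles in [0, pi]
  to all angles.\<close>

lemma poly_chebyshev_poly_cos: "poly (chebyshev_poly k) (cos t) = cos (real k * t)"
proof -
  define s where "s = arccos (cos t)"
  have "cos s = cos t" by (simp add: s_def)
  then obtain j :: int where "s = t + 2 * pi * j \<or> s = - t + 2 * pi * j"
    using cos_eq_cosD by blast
  then have "real k * s = real k * t + 2 * pi * (int k * j) \<or>
      real k * s = - (real k * t) + 2 * pi * (int k * j)"
    by (elim disj_forward) (simp_all add: distrib_left right_diff_distrib mult.left_commute)
  then have "cos (real k * s) = cos (real k * t)"
    by (metis cos_add_2pi_int cos_minus)
  then show ?thesis by (simp add: poly_chebyshev_poly s_def)
qed

text \<open>Derivative of the previous identity. The factor \<open>sin t\<close> is kept on the left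
  so that the formula also covers the angles where it is 0.\<close>

lemma pderiv_chebyshev_poly_cos:
  "poly (pderiv (chebyshev_poly k)) (cos t) * sin t = real k * sin (real k * t)"
proof -
  have "((\<lambda>t. poly (chebyshev_poly k) (cos t)) has_real_derivative
      poly (pderiv (chebyshev_poly k)) (cos t) * - sin t) (at t)"
    by (auto intro!: derivative_eq_intros DERIV_chain2[OF poly_DERIV])
  moreover have "((\<lambda>t. poly (chebyshev_poly k) (cos t)) has_real_derivative
      - sin (real k * t) * real k) (at t)"
    unfolding poly_chebyshev_poly_cos by (auto intro!: derivative_eq_intros)
  ultimately show ?thesis using DERIV_unique by fastforce
qed

text \<open>Differentiating \<open>T\<^sub>k'(cos t) sin t = k sin (k t)\<close> once more gives the value of \<open>T\<^sub>k'\<close>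
  where \<open>sin t = 0\<close>.\<close>

lemma pderiv2_chebyshev_poly_cos:
  "poly (pderiv (chebyshev_poly k)) (cos t) * cos t -
     poly (pderiv (pderiv (chebyshev_poly k))) (cos t) * (sin t)\<^sup>2
   = (real k)\<^sup>2 * cos (real k * t)"
proof -
  have "((\<lambda>t. poly (pderiv (chebyshev_poly k)) (cos t) * sin t) has_real_derivative
      poly (pderiv (pderiv (chebyshev_poly k))) (cos t) * - sin t * sin t +
      poly (pderiv (chebyshev_poly k)) (cos t) * cos t) (at t)"
    by (auto intro!: derivative_eq_intros DERIV_chain2[OF poly_DERIV])
  moreover have "((\<lambda>t. poly (pderiv (chebyshev_poly k)) (cos t) * sin t) has_real_derivative
      real k * (cos (real k * t) * real k)) (at t)"
    unfolding pderiv_chebyshev_poly_cos by (auto intro!: derivative_eq_intros)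
  ultimately show ?thesis
    using DERIV_unique by (fastforce simp: power2_eq_square algebra_simps)
qed

text \<open>At an end point x = cos t one has \<open>sin t = 0\<close>, and the second-order
  identity reduces to T_k'(x) cos t = k^2 cos (k t), whose right side is nonzero. In the interior
  \<open>sin t\<close> can be cancelled, so the zeros of T_k' are those of sin (k t), where |cos (k
  t)| = 1.\<close>

lemma pderiv_chebyshev_poly_eq_0_iff:
  assumes k: "k \<ge> 1" and x: "x \<in> {-1..1}"
  shows "poly (pderiv (chebyshev_poly k)) x = 0 \<longleftrightarrow>
    x \<in> {-1<..<1} \<and> \<bar>poly (chebyshev_poly k) x\<bar> = 1"
proof -
  define t where "t = arccos x"
  have xt: "x = cos t" using x by (simp add: t_def)
  have interior: "x \<in> {-1<..<1} \<longleftrightarrow> sin t \<noteq> 0"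
    unfolding abs_cos_eq_1_iff[symmetric] xt greaterThanLessThan_iff
    using cos_ge_minus_one[of t] cos_le_one[of t] by arith
  show ?thesis
  proof (cases "sin t = 0")
    case True
    then have "sin (real k * t) = 0"
      using pderiv_chebyshev_poly_cos[of k t] k by simp
    then have "cos (real k * t) \<noteq> 0" using abs_cos_eq_1_iff[of "real k * t"] by auto
    then show ?thesis
      using pderiv2_chebyshev_poly_cos[of k t] True interior k by (auto simp: xt)
  next
    case False
    have "poly (pderiv (chebyshev_poly k)) x = 0 \<longleftrightarrow> sin (real k * t) = 0"
      using pderiv_chebyshev_poly_cos[of k t] False k by (auto simp: xt)
    then show ?thesis
      using interior False by (simp add: xt poly_chebyshev_poly_cos abs_cos_eq_1_iff)
  qed
qed

text \<open>For x = cos t with t in [0, pi], the value cos (k t) is 1 or -1 only if k t = i pi. The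
  range of t bounds i by 0 and k, and the parity of i determines the sign.\<close>

lemma chebyshev_poly_eq_sign_iff:
  assumes k: "k \<ge> 1" and r: "r \<in> {0, 1}" and x: "x \<in> {-1..1}"
  shows "poly (chebyshev_poly k) x = (-1) ^ r \<longleftrightarrow>
    (\<exists>i\<le>k. [i = r] (mod 2) \<and> x = cos (real i * pi / real k))"
proof
  assume "\<exists>i\<le>k. [i = r] (mod 2) \<and> x = cos (real i * pi / real k)"
  then obtain i where i: "[i = r] (mod 2)" "x = cos (real i * pi / real k)" by blast
  have "poly (chebyshev_poly k) x = cos (real i * pi)"
    using k by (simp add: i poly_chebyshev_poly_cos)
  also have "\<dots> = (-1) ^ i" by (rule cos_npi)
  also have "\<dots> = (-1) ^ r"
    using i(1) by (simp add: minus_one_power_iff cong_def even_iff_mod_2_eq_zero)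
  finally show "poly (chebyshev_poly k) x = (-1) ^ r" .
next
  assume eq: "poly (chebyshev_poly k) x = (-1) ^ r"
  define t where "t = arccos x"
  have t: "0 \<le> t" "t \<le> pi" "x = cos t"
    using x by (auto simp: t_def intro: arccos_lbound arccos_ubound)
  have ct: "cos (real k * t) = (-1) ^ r"
    using eq by (simp add: t poly_chebyshev_poly_cos)
  then have "\<bar>cos (real k * t)\<bar> = 1" by (simp add: power_abs)
  then have "sin (real k * t) = 0" by (simp add: abs_cos_eq_1_iff)
  then obtain j :: int where j: "real k * t = j * pi" by (auto simp: sin_zero_iff_int2)
  have "0 \<le> j * pi" "j * pi \<le> real k * pi"
    using t k by (simp_all flip: j)
  then have "0 \<le> j" "j \<le> int k"
    using pi_gt_zero by (auto simp: zero_le_mult_iff simp del: pi_gt_zero)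
  then obtain i where i: "j = int i" "i \<le> k" by (metis nonneg_int_cases of_nat_le_iff)
  have "(-1) ^ i = ((-1) ^ r :: real)"
    using ct j cos_npi[of i] by (simp add: i)
  then have "[i = r] (mod 2)"
    using r by (auto simp: minus_one_power_iff cong_def even_iff_mod_2_eq_zero split: if_splits)
  moreover have "x = cos (real i * pi / real k)"
  proof -
    have "t = real i * pi / real k" using j k by (simp add: i(1) field_simps)
    then show ?thesis by (simp add: t(3))
  qed
  ultimately show "\<exists>i\<le>k. [i = r] (mod 2) \<and> x = cos (real i * pi / real k)"
    using i by blast
qed

text \<open>The cosine is strictly decreasing on [0, pi], so only i = 0 and i = k reach 1 and -1.
  This translates the index condition attached to M into a condition on the face of the
  cube.\<close>

lemma cos_in_interior_iff:
  assumes "k \<ge> 1" and "i \<le> k"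
  shows "cos (real i * pi / real k) \<in> {-1<..<1} \<longleftrightarrow> 0 < i \<and> i < k"
proof -
  consider "i = 0" | "i = k" | "0 < i" "i < k" using assms by linarith
  then show ?thesis
  proof cases
    case 3
    then have "real i * pi / real k \<in> {0<..<pi}" by (simp add: field_simps)
    then show ?thesis
      using 3 cos_monotone_0_pi[of 0 "real i * pi / real k"]
        cos_monotone_0_pi[of "real i * pi / real k" pi] by auto
  qed (use assms in auto)
qed

section \<open>The variety as the trace of the Lissajous curve\<close>

lemma chebyshev_variety_eq_range:
  fixes n :: "nat vec"
  assumes n: "n \<in> carrier_vec d" and pos: "\<forall>i<d. n $ i \<ge> 1"
    and cop: "\<forall>i<d. \<forall>j<d. i \<noteq> j \<longrightarrow> coprime (n $ i) (n $ j)" and d: "d \<ge> 1"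
  shows "chebyshev_variety n = range (lissajous_curve n)"
proof
  have dim: "dim_vec n = d" using n by simp
  define P where "P = (\<Prod>j<d. n $ j)"
  have P: "n $ i * (\<Prod>j\<in>{..<d} - {i}. n $ j) = P" if "i < d" for i
    unfolding P_def using that by (simp add: prod.remove)
  show "range (lissajous_curve n) \<subseteq> chebyshev_variety n"
  proof -
    have "poly (chebyshev_poly (n $ i)) (lissajous_curve n t $ i) = cos (real P * t)"
      if "i < d" for i t
      using that by (simp add: lissajous_curve_def dim poly_chebyshev_poly_cos
          mult.assoc[symmetric] P of_nat_mult[symmetric] del: of_nat_mult of_nat_prod)
    then show ?thesis
      by (auto simp: chebyshev_variety_def unit_cube_def dim lissajous_curve_def)
  qed
  show "chebyshev_variety n \<subseteq> range (lissajous_curve n)"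
  proof
    fix x assume "x \<in> chebyshev_variety n"
    then have xd: "x \<in> carrier_vec d" and x: "\<And>i. i < d \<Longrightarrow> x $ i \<in> {-1..1}"
      and eq: "\<And>i j. i < d \<Longrightarrow> j < d \<Longrightarrow>
        poly (chebyshev_poly (n $ i)) (x $ i) = poly (chebyshev_poly (n $ j)) (x $ j)"
      unfolding chebyshev_variety_def unit_cube_def dim by blast+
    \<comment> \<open>\<open>cos \<tau>\<close> is the common value of all T_{n_i}(x_i); coordinate
      0 exists because d is at least 1.\<close>
    define \<tau> where "\<tau> = real (n $ 0) * arccos (x $ 0)"
    have "\<exists>k::int. x $ i = cos ((\<tau> + 2 * pi * k) / n $ i)" if i: "i < d" for i
    proof -
      define \<theta> where "\<theta> = arccos (x $ i)"
      have \<theta>: "x $ i = cos \<theta>" using x[OF i] by (simp add: \<theta>_def)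
      have ni: "n $ i \<ge> 1" using pos i by simp
      have "cos (real (n $ i) * \<theta>) = cos \<tau>"
        using eq[OF i, of 0] d x[OF i] x[of 0]
        by (simp add: poly_chebyshev_poly \<theta>_def \<tau>_def)
      then obtain k :: int where
        "real (n $ i) * \<theta> = \<tau> + 2 * pi * k \<or> real (n $ i) * \<theta> = - \<tau> + 2 * pi * k"
        using cos_eq_cosD by blast
      \<comment> \<open>In the second case the angle is negated, which the evenness of the cosine
        absorbs, and k becomes -k.\<close>
      then have "\<theta> = (\<tau> + 2 * pi * k) / n $ i \<or> - \<theta> = (\<tau> + 2 * pi * (- k :: int)) / n $ i"
        using ni by (auto simp: field_simps)
      then show ?thesis unfolding \<theta> by (metis cos_minus)
    qed
    then obtain k :: "nat \<Rightarrow> int" where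
      k: "\<And>i. i < d \<Longrightarrow> x $ i = cos ((\<tau> + 2 * pi * k i) / n $ i)" by metis
    \<comment> \<open>Reducing k_i modulo n_i gives natural residues, as the remainder theorem on
      \<open>nat\<close> requires; m is then congruent to k_i modulo n_i for every i.\<close>
    obtain m :: nat where m: "\<forall>i\<in>{..<d}. [m = nat (k i mod int (n $ i))] (mod n $ i)"
      using chinese_remainder_nat[of "{..<d}" "\<lambda>i. n $ i" "\<lambda>i. nat (k i mod int (n $ i))"] cop
      by auto
    have "lissajous_curve n ((\<tau> + 2 * pi * m) / P) $ i = x $ i" if i: "i < d" for i
    proof -
      have ni: "n $ i \<ge> 1" using pos i by simp
      have "[int m = int (nat (k i mod int (n $ i)))] (mod int (n $ i))"
        using m i by (simp only: cong_int_iff lessThan_iff)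
      then have "[k i = int m] (mod int (n $ i))"
        using ni by (simp add: cong_def)
      \<comment> \<open>Replacing k_i by m changes the angle of coordinate i by l full
        turns.\<close>
      then obtain l where l: "int m = k i + int (n $ i) * l"
        by (auto simp: cong_iff_lin)
      have P0: "P > 0" unfolding P_def
        using pos by (intro prod_pos) (auto simp: Suc_le_eq)
      define q where "q = (\<Prod>j\<in>{..<d} - {i}. n $ j)"
      have q: "real P = real (n $ i) * real q"
        using P[OF i] by (metis of_nat_mult q_def)
      then have q0: "real q \<noteq> 0" using P0 by (intro notI) simp
      have "real q * ((\<tau> + 2 * pi * m) / P) = (\<tau> + 2 * pi * m) / n $ i"
        unfolding q using q0 ni by (simp add: field_simps)
      also have "\<dots> = (\<tau> + 2 * pi * k i) / n $ i + 2 * pi * l"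
      proof -
        have "real m = real_of_int (k i) + real (n $ i) * l"
          using arg_cong[OF l, of real_of_int] by simp
        moreover have "real (n $ i) \<noteq> 0" using ni by simp
        ultimately show ?thesis by (simp add: add_divide_distrib distrib_left)
      qed
      finally have "cos (real q * ((\<tau> + 2 * pi * m) / P)) = x $ i"
        by (simp only: cos_add_2pi_int k[OF i])
      then show ?thesis using i by (simp add: lissajous_curve_def dim q_def)
    qed
    then have "x = lissajous_curve n ((\<tau> + 2 * pi * m) / P)"
      using xd by (intro eq_vecI) (auto simp: lissajous_curve_def dim)
    then show "x \<in> range (lissajous_curve n)" by blast
  qed
qed

text \<open>Each coordinate is a polynomial in \<open>cos t\<close>, so parameters with equal
  cosines give the same point.\<close>

lemma lissajous_curve_arccos_cos: "lissajous_curve n (arccos (cos t)) = lissajous_curve n t"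
proof -
  have "cos (real p * arccos (cos t)) = cos (real p * t)" for p
    by (metis poly_chebyshev_poly_cos cos_arccos_abs abs_cos_le_one)
  then show ?thesis unfolding lissajous_curve_def by presburger
qed

text \<open>\<open>arccos (cos t)\<close> lies in [0, pi], so these parameters already reach every
  point. The general S serves both [0, 2 pi) and [0, pi].\<close>

lemma lissajous_curve_image_eq_range:
  assumes "{0..pi} \<subseteq> S"
  shows "lissajous_curve n ` S = range (lissajous_curve n)"
proof -
  have "lissajous_curve n t \<in> lissajous_curve n ` S" for t
    using assms arccos_lbound[of "cos t"] arccos_ubound[of "cos t"]
    by (intro image_eqI[where x = "arccos (cos t)"]) (auto simp: lissajous_curve_arccos_cos)
  then show ?thesis by auto
qed

section \<open>The sets \<open>LC_parity\<close> as points of a face with extremal Chebyshev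
  values\<close>

lemma LC_parity_eq:
  fixes n :: "nat vec"
  assumes n: "n \<in> carrier_vec d" and pos: "\<forall>i<d. n $ i \<ge> 1" and r: "r \<in> {0, 1}"
  shows "LC_parity n M r =
    {x \<in> cube_face d M. \<forall>i<d. poly (chebyshev_poly (n $ i)) (x $ i) = (-1) ^ r}"
    (is "_ = ?R")
proof
  have dim: "dim_vec n = d" using n by simp
  show "LC_parity n M r \<subseteq> ?R"
  proof
    fix x assume "x \<in> LC_parity n M r"
    then obtain i where i: "x = z_point n i" "\<And>j. j < d \<Longrightarrow> i $ j \<le> n $ j"
        "\<And>j. j < d \<Longrightarrow> [i $ j = r] (mod 2)"
        "\<And>j. j < d \<Longrightarrow> (0 < i $ j \<and> i $ j < n $ j) \<longleftrightarrow> j \<in> M"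
      by (auto simp: LC_parity_def index_set_on_def index_set_def dim)
    have x: "x \<in> carrier_vec d" "\<And>j. j < d \<Longrightarrow> x $ j = cos (real (i $ j) * pi / real (n $ j))"
      by (auto simp: i z_point_def dim)
    have cube: "x \<in> unit_cube d" using x by (auto simp: unit_cube_def)
    have int: "x $ j \<in> {-1<..<1} \<longleftrightarrow> j \<in> M" if "j < d" for j
      using cos_in_interior_iff[of "n $ j" "i $ j"] pos i that x by auto
    have "x $ j \<in> {-1, 1}" if "j < d" "j \<notin> M" for j
      using cube int[of j] that by (force simp: unit_cube_def)
    then have "x \<in> cube_face d M" using cube int by (auto simp: cube_face_def)
    moreover have "poly (chebyshev_poly (n $ j)) (x $ j) = (-1) ^ r" if "j < d" for j
    proof -
      have "x $ j \<in> {-1..1}" using cube that by (simp add: unit_cube_def)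
      then show ?thesis
        using chebyshev_poly_eq_sign_iff[of "n $ j" r "x $ j"] pos r i x that by blast
    qed
    ultimately show "x \<in> ?R" by blast
  qed
  show "?R \<subseteq> LC_parity n M r"
  proof
    fix x assume xR: "x \<in> ?R"
    then have x: "x \<in> carrier_vec d" "\<And>j. j < d \<Longrightarrow> x $ j \<in> {-1..1}"
      by (auto simp: cube_face_def unit_cube_def)
    \<comment> \<open>The sign condition yields an index for each coordinate separately; these are
      later assembled into the multi-index \<open>vec d f\<close>.\<close>
    have "\<exists>i\<le>n $ j. [i = r] (mod 2) \<and> x $ j = cos (real i * pi / real (n $ j))" if "j < d" for j
      using chebyshev_poly_eq_sign_iff[of "n $ j" r "x $ j"] pos r x that xR by blast
    then obtain f where f: "\<And>j. j < d \<Longrightarrow> f j \<le> n $ j"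
        "\<And>j. j < d \<Longrightarrow> [f j = r] (mod 2)"
        "\<And>j. j < d \<Longrightarrow> x $ j = cos (real (f j) * pi / real (n $ j))" by metis
    have "(0 < f j \<and> f j < n $ j) \<longleftrightarrow> j \<in> M" if "j < d" for j
    proof -
      have "x $ j \<in> {-1<..<1} \<longleftrightarrow> j \<in> M"
        using xR that by (auto simp: cube_face_def)
      then show ?thesis
        using cos_in_interior_iff[of "n $ j" "f j"] pos f that by simp
    qed
    then have "vec d f \<in> index_set_on n M r"
      using f by (simp add: index_set_on_def index_set_def dim)
    moreover have "x = z_point n (vec d f)"
      using x f by (intro eq_vecI) (auto simp: z_point_def dim)
    ultimately show "x \<in> LC_parity n M r" by (auto simp: LC_parity_def)
  qed
qed

section \<open>Full row rank, left kernels and bidiagonal matrices\<close>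

lemma (in vec_space) rank_eq_nrows_iff_col_space:
  assumes A: "A \<in> carrier_mat n nc"
  shows "rank A = n \<longleftrightarrow> col_space A = carrier_vec n"
proof
  have cols: "set (cols A) \<subseteq> carrier_vec n" using A cols_dim by fastforce
  {
    assume "rank A = n"
    \<comment> \<open>The empty set is the start for a maximal independent set of columns. When
      \<open>rank A = n\<close>, that set has n elements and is therefore a basis.\<close>
    have lin_indpt_empty: "lin_indpt {}"
      using subset_li_is_li[of "set (unit_vecs n)" "{}"] unit_vecs_basis by (simp add: basis_def)
    obtain S where S: "maximal S (\<lambda>T. T \<subseteq> set (cols A) \<and> lin_indpt T)" "finite S"
      using maximal_exists_superset[of "set (cols A)" "\<lambda>T. T \<subseteq> set (cols A) \<and> lin_indpt T" "{}"]
        lin_indpt_empty by auto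
    then have "card S = n" "lin_indpt S" "S \<subseteq> set (cols A)"
      using rank_card_indpt[OF A] \<open>rank A = n\<close> by (auto simp: maximal_def)
    then have "basis S"
      using dim_li_is_basis[of S] S cols dim_is_n by auto
    then have "span S = carrier_vec n" by (simp add: basis_def)
    then show "col_space A = carrier_vec n"
      unfolding col_space_def
      using span_is_monotone[OF \<open>S \<subseteq> set (cols A)\<close>] span_is_subset2[OF cols] by auto
  }
  assume "col_space A = carrier_vec n"
  then have "span_vs (set (cols A)) = V"
    by (simp add: col_space_def)
  then show "rank A = n"
    unfolding rank_def using dim_is_n by simp
qed

text \<open>If the left kernel of \<open>A\<close> is trivial, so is the kernel of \<open>A A\<^sup>T\<close>, because
  \<open>v \<bullet> (A A\<^sup>T v)\<close> is the square of the norm of \<open>A\<^sup>T v\<close>; hence \<open>A A\<^sup>T\<close>, and a fortiori \<open>A\<close>, is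
  surjective.\<close>

lemma rank_eq_nrows_iff_left_kernel:
  fixes A :: "real mat"
  assumes A: "A \<in> carrier_mat m k"
  shows "vec_space.rank m A = m \<longleftrightarrow> (\<forall>v\<in>carrier_vec m. A\<^sup>T *\<^sub>v v = 0\<^sub>v k \<longrightarrow> v = 0\<^sub>v m)"
proof -
  interpret vec_space "TYPE(real)" m .
  have zero: "v = 0\<^sub>v l" if "v \<in> carrier_vec l" "v \<bullet> v = 0" for v :: "real vec" and l
    using that by (intro eq_vecI) (auto simp: scalar_prod_def sum_nonneg_eq_0_iff)
  have At: "A\<^sup>T \<in> carrier_mat k m" using A by simp
  have "rank A = m \<longleftrightarrow> (\<forall>y\<in>carrier_vec m. \<exists>x\<in>carrier_vec k. A *\<^sub>v x = y)"
    using A mult_mat_vec_carrier[OF A]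
    by (auto simp: rank_eq_nrows_iff_col_space[OF A] col_space_eq[OF A])
  also have "\<dots> \<longleftrightarrow> (\<forall>v\<in>carrier_vec m. A\<^sup>T *\<^sub>v v = 0\<^sub>v k \<longrightarrow> v = 0\<^sub>v m)"
  proof safe
    fix v assume surj: "\<forall>y\<in>carrier_vec m. \<exists>x\<in>carrier_vec k. A *\<^sub>v x = y"
      and v: "v \<in> carrier_vec m" "A\<^sup>T *\<^sub>v v = 0\<^sub>v k"
    then obtain x where x: "x \<in> carrier_vec k" "A *\<^sub>v x = v" by blast
    \<comment> \<open>A left kernel vector is orthogonal to the column space, which here contains v
      itself.\<close>
    have "v \<bullet> v = (A\<^sup>T *\<^sub>v v) \<bullet> x"
      using transpose_vec_mult_scalar[OF A x(1) v(1)] x by simp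
    then show "v = 0\<^sub>v m" using zero v x by simp
  next
    fix y :: "real vec"
    assume ker: "\<forall>v\<in>carrier_vec m. A\<^sup>T *\<^sub>v v = 0\<^sub>v k \<longrightarrow> v = 0\<^sub>v m" and y: "y \<in> carrier_vec m"
    have AAt: "A * A\<^sup>T \<in> carrier_mat m m" using A by simp
    have "v = 0\<^sub>v m" if v: "v \<in> carrier_vec m" "(A * A\<^sup>T) *\<^sub>v v = 0\<^sub>v m" for v
    proof -
      have Atv: "A\<^sup>T *\<^sub>v v \<in> carrier_vec k" using At v by simp
      have "(A\<^sup>T *\<^sub>v v) \<bullet> (A\<^sup>T *\<^sub>v v) = v \<bullet> ((A * A\<^sup>T) *\<^sub>v v)"
        using transpose_vec_mult_scalar[OF A Atv v(1)] assoc_mult_mat_vec[OF A At v(1)] by simp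
      then show ?thesis using zero[OF Atv] ker v by simp
    qed
    then have "det (A * A\<^sup>T) \<noteq> 0" using det_0_iff_vec_prod_zero_field[OF AAt] by blast
    then obtain B where B: "B \<in> carrier_mat m m" "(A * A\<^sup>T) * B = 1\<^sub>m m"
      using det_non_zero_imp_unit[OF AAt, of "()"] by (auto simp: Units_def ring_mat_simps)
    have By: "B *\<^sub>v y \<in> carrier_vec m" using B y by simp
    have "A *\<^sub>v (A\<^sup>T *\<^sub>v (B *\<^sub>v y)) = y"
      using assoc_mult_mat_vec[OF A At By] assoc_mult_mat_vec[OF AAt B(1) y] B y by simp
    then show "\<exists>x\<in>carrier_vec k. A *\<^sub>v x = y" using At By by (metis mult_mat_vec_carrier)
  qed
  finally show ?thesis .
qed

text \<open>Padding \<open>v\<close> with a zero at both ends to \<open>w\<close>, entry \<open>j\<close> of \<open>A\<^sup>T v\<close> is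
  \<open>a j * (w (j + 1) - w j)\<close>. So a vector of the left kernel can only jump at zeros of \<open>a\<close>, and
  it has to jump twice unless it vanishes.\<close>

lemma rank_difference_mat_iff:
  fixes a :: "nat \<Rightarrow> real"
  assumes d: "d \<ge> 1"
  defines "A \<equiv> mat (d - 1) d (\<lambda>(i, j). if j = i then a j else if j = Suc i then - a j else 0)"
  shows "vec_space.rank (d - 1) A = d - 1 \<longleftrightarrow> \<not> (\<exists>p q. p < q \<and> q < d \<and> a p = 0 \<and> a q = 0)"
proof -
  define w where "w v j = (if j = 0 \<or> j = d then 0 else v $ (j - 1))" for v :: "real vec" and j
  have A: "A \<in> carrier_mat (d - 1) d" by (simp add: A_def)
  have entry: "(A\<^sup>T *\<^sub>v v) $ j = a j * (w v (Suc j) - w v j)"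
    if v: "v \<in> carrier_vec (d - 1)" and j: "j < d" for v j
  proof -
    have "(A\<^sup>T *\<^sub>v v) $ j =
        (\<Sum>i<d - 1. (if j = i then a j else if j = Suc i then - a j else 0) * v $ i)"
      using v j by (simp add: A_def scalar_prod_def lessThan_atLeast0)
    \<comment> \<open>Both ends agree with the padding: for j = d - 1 the index i = j is outside the
      sum, and for j = 0 the inner test cancels the term that truncated subtraction would put at i =
      0.\<close>
    also have "\<dots> = (\<Sum>i<d - 1. (if i = j then a j * v $ j else 0) +
        (if i = j - 1 then (if j = 0 then 0 else - a j * v $ (j - 1)) else 0))"
      by (intro sum.cong) auto
    also have "\<dots> = a j * (w v (Suc j) - w v j)"
      using j by (auto simp: sum.distrib w_def algebra_simps)
    finally show ?thesis .
  qed
  have ker: "A\<^sup>T *\<^sub>v v = 0\<^sub>v d \<longleftrightarrow> (\<forall>j<d. a j * (w v (Suc j) - w v j) = 0)"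
    if v: "v \<in> carrier_vec (d - 1)" for v
    using entry[OF v] A by (auto simp: vec_eq_iff)
  have "(\<forall>v\<in>carrier_vec (d - 1). A\<^sup>T *\<^sub>v v = 0\<^sub>v d \<longrightarrow> v = 0\<^sub>v (d - 1)) \<longleftrightarrow>
      \<not> (\<exists>p q. p < q \<and> q < d \<and> a p = 0 \<and> a q = 0)" (is "?K \<longleftrightarrow> \<not> ?Z")
  proof
    assume ?K
    show "\<not> ?Z"
    proof
      assume ?Z
      then obtain p q where pq: "p < q" "q < d" "a p = 0" "a q = 0" by blast
      \<comment> \<open>After padding, this is the indicator of p < j <= q, whose only jumps are
        from p to p + 1 and from q to q + 1; there the factors \<open>a p\<close> and
        \<open>a q\<close> vanish.\<close>
      define v :: "real vec" where "v = vec (d - 1) (\<lambda>i. if p \<le> i \<and> i < q then 1 else 0)"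
      have v: "v \<in> carrier_vec (d - 1)" by (simp add: v_def)
      have "w v j = (if p < j \<and> j \<le> q then 1 else 0)" if "j \<le> d" for j
        using that pq by (auto simp: w_def v_def)
      then have "w v (Suc j) = w v j" if "j < d" "j \<noteq> p" "j \<noteq> q" for j
        using that by auto
      then have "\<forall>j<d. a j * (w v (Suc j) - w v j) = 0"
        using pq by (metis diff_self mult_zero_left mult_zero_right)
      then have "v = 0\<^sub>v (d - 1)" using \<open>?K\<close> ker[OF v] v by blast
      then have "v $ p = 0" using pq by simp
      then show False using pq by (simp add: v_def)
    qed
  next
    assume nZ: "\<not> ?Z"
    \<comment> \<open>p is the only zero of \<open>a\<close> below d, or arbitrary if there is
      none.\<close>
    obtain p where p: "\<And>j. j < d \<Longrightarrow> j \<noteq> p \<Longrightarrow> a j \<noteq> 0"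
      using nZ by (metis nat_neq_iff)
    show ?K
    proof (intro ballI impI)
      fix v assume v: "v \<in> carrier_vec (d - 1)" "A\<^sup>T *\<^sub>v v = 0\<^sub>v d"
      have const: "w v (Suc j) = w v j" if "j < d" "j \<noteq> p" for j
        using v ker[OF v(1)] p[OF that] that by auto
      \<comment> \<open>The padding zeros spread inwards: from 0 up to p, and from d down to p + 1.
        Together they cover all entries.\<close>
      have low: "j \<le> p \<Longrightarrow> j \<le> d \<Longrightarrow> w v j = 0" for j
      proof (induction j)
        case 0
        show ?case by (simp add: w_def)
      next
        case (Suc j)
        then show ?case using const[of j] by simp
      qed
      have high: "w v j = 0" if "j \<le> d" "p < j" for j
        using that
      proof (induction j rule: inc_induct)
        case base
        show ?case by (simp add: w_def)
      next
        case (step j)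
        then show ?case using const[of j] by simp
      qed
      have "v $ i = 0" if "i < d - 1" for i
      proof -
        have "Suc i < d" using that by simp
        then have "w v (Suc i) = 0" using low high by (cases "Suc i \<le> p") auto
        then show ?thesis using \<open>Suc i < d\<close> by (simp add: w_def)
      qed
      then show "v = 0\<^sub>v (d - 1)" using v by (intro eq_vecI) auto
    qed
  qed
  then show ?thesis using rank_eq_nrows_iff_left_kernel[OF A] by simp
qed

section \<open>The Jacobian and the singular points\<close>

lemma partial_deriv_chebyshev_eqn:
  fixes n :: "nat vec" and x :: "real vec"
  assumes "i < dim_vec x - 1" and "j < dim_vec x"
  shows "partial_deriv (chebyshev_eqn n i) j x =
    (if j = i then poly (pderiv (chebyshev_poly (n $ j))) (x $ j)
     else if j = Suc i then - poly (pderiv (chebyshev_poly (n $ j))) (x $ j) else 0)"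
proof -
  have "((\<lambda>t. chebyshev_eqn n i (x |\<^sub>v j \<mapsto> t)) has_real_derivative
    (if j = i then poly (pderiv (chebyshev_poly (n $ j))) (x $ j)
     else if j = Suc i then - poly (pderiv (chebyshev_poly (n $ j))) (x $ j) else 0)) (at (x $ j))"
    using assms by (auto simp: chebyshev_eqn_def intro!: derivative_eq_intros poly_DERIV)
  then show ?thesis unfolding partial_deriv_def by (rule DERIV_imp_deriv)
qed

text \<open>The Jacobian is the matrix of \<open>rank_difference_mat_iff\<close> with
  \<open>a j\<close> = T_{n_j}'(x_j), and \<open>pderiv_chebyshev_poly_eq_0_iff\<close> locates the
  zeros of these derivatives.\<close>

lemma singular_point_iff:
  fixes n :: "nat vec" and x :: "real vec"
  assumes n: "n \<in> carrier_vec d" and pos: "\<forall>i<d. n $ i \<ge> 1" and d: "d \<ge> 1"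
    and x: "x \<in> chebyshev_variety n"
  shows "singular_point n x \<longleftrightarrow>
    (\<exists>p q. p < q \<and> q < d \<and> (\<forall>i\<in>{p, q}. x $ i \<in> {-1<..<1}) \<and>
      (\<forall>i\<in>{p, q}. \<bar>poly (chebyshev_poly (n $ i)) (x $ i)\<bar> = 1))"
proof -
  define a where "a j = poly (pderiv (chebyshev_poly (n $ j))) (x $ j)" for j
  have dim: "dim_vec n = d" "dim_vec x = d" and cube: "\<And>i. i < d \<Longrightarrow> x $ i \<in> {-1..1}"
    using n x by (auto simp: chebyshev_variety_def unit_cube_def)
  have "jacobian_mat (d - 1) (chebyshev_eqn n) x =
      mat (d - 1) d (\<lambda>(i, j). if j = i then a j else if j = Suc i then - a j else 0)"
    unfolding jacobian_mat_def dim a_def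
    by (intro cong_mat refl) (simp add: partial_deriv_chebyshev_eqn dim)
  then have "singular_point n x \<longleftrightarrow> (\<exists>p q. p < q \<and> q < d \<and> a p = 0 \<and> a q = 0)"
    unfolding singular_point_def dim using x rank_difference_mat_iff[OF d, of a] by metis
  moreover have "a j = 0 \<longleftrightarrow> x $ j \<in> {-1<..<1} \<and> \<bar>poly (chebyshev_poly (n $ j)) (x $ j)\<bar> = 1"
    if "j < d" for j
    unfolding a_def using pderiv_chebyshev_poly_eq_0_iff cube pos that by simp
  ultimately show ?thesis by (auto 0 4)
qed

theorem theorem2p3:
  fixes d :: nat and n :: "nat vec"
  assumes "d \<ge> 1"
    and "n \<in> carrier_vec d"
    and "\<forall>i<d. n $ i \<ge> 1"
    and "\<forall>i<d. \<forall>j<d. i \<noteq> j \<longrightarrow> coprime (n $ i) (n $ j)"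
  shows "(chebyshev_variety n = lissajous_curve n ` {0..<2 * pi} \<and>
          lissajous_curve n ` {0..<2 * pi} = lissajous_curve n ` {0..pi}) \<and>
         (\<forall>x\<in>chebyshev_variety n.
            singular_point n x \<longleftrightarrow> (\<exists>M\<subseteq>{..<d}. card M \<ge> 2 \<and> x \<in> LC n M)) \<and>
         (\<forall>M\<subseteq>{..<d}. \<forall>r\<in>{0, 1}.
            LC_parity n M r =
              {x \<in> cube_face d M. \<forall>i<d. poly (chebyshev_poly (n $ i)) (x $ i) = (-1) ^ r})"
proof (intro conjI ballI allI impI)
  have "{0..pi} \<subseteq> {0..<2 * pi}" using pi_gt_zero by (auto simp del: pi_gt_zero)
  note image = lissajous_curve_image_eq_range[OF this] lissajous_curve_image_eq_range[OF order_refl]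
  show "chebyshev_variety n = lissajous_curve n ` {0..<2 * pi}"
    unfolding image by (rule chebyshev_variety_eq_range[OF assms(2-4,1)])
  show "lissajous_curve n ` {0..<2 * pi} = lissajous_curve n ` {0..pi}"
    unfolding image ..
next
  fix M r assume "r \<in> {0, 1::nat}"
  then show "LC_parity n M r =
      {x \<in> cube_face d M. \<forall>i<d. poly (chebyshev_poly (n $ i)) (x $ i) = (-1) ^ r}"
    by (rule LC_parity_eq[OF assms(2,3)])
next
  \<comment> \<open>The two parities become the two possible common values 1 and -1.\<close>
  have LC: "LC n M = {x \<in> cube_face d M.
      \<exists>r\<in>{0, 1}. \<forall>i<d. poly (chebyshev_poly (n $ i)) (x $ i) = (-1) ^ r}" for M
    unfolding LC_def
    using LC_parity_eq[OF assms(2,3), of 0 M] LC_parity_eq[OF assms(2,3), of 1 M] by auto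
  fix x assume x: "x \<in> chebyshev_variety n"
  then have cube: "x \<in> unit_cube d" and eq: "\<And>i j. i < d \<Longrightarrow> j < d \<Longrightarrow>
      poly (chebyshev_poly (n $ i)) (x $ i) = poly (chebyshev_poly (n $ j)) (x $ j)"
    using assms(2) unfolding chebyshev_variety_def carrier_vec_def by blast+
  note sing = singular_point_iff[OF assms(2,3,1) x]
  show "singular_point n x \<longleftrightarrow> (\<exists>M\<subseteq>{..<d}. card M \<ge> 2 \<and> x \<in> LC n M)"
  proof
    assume "singular_point n x"
    then obtain p q where pq: "p < q" "q < d" "x $ p \<in> {-1<..<1}" "x $ q \<in> {-1<..<1}"
      "\<bar>poly (chebyshev_poly (n $ p)) (x $ p)\<bar> = 1"
      unfolding sing by auto
    \<comment> \<open>M has to contain every interior coordinate, since the face requires all others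
      to be 1 or -1.\<close>
    define M where "M = {i. i < d \<and> x $ i \<in> {-1<..<1}}"
    have M: "M \<subseteq> {..<d}" by (auto simp: M_def)
    have "card {p, q} \<le> card M"
      using pq M by (intro card_mono) (auto simp: M_def)
    then have "card M \<ge> 2" using pq by simp
    moreover have "x \<in> cube_face d M"
      using cube by (force simp: cube_face_def M_def unit_cube_def)
    \<comment> \<open>The sign at the single coordinate p suffices, because all Chebyshev values
      agree on the variety.\<close>
    moreover have "\<exists>r\<in>{0, 1::nat}. poly (chebyshev_poly (n $ p)) (x $ p) = (-1) ^ r"
      using pq(5) by (auto simp: abs_if split: if_splits)
    then have "\<exists>r\<in>{0, 1::nat}. \<forall>i<d. poly (chebyshev_poly (n $ i)) (x $ i) = (-1) ^ r"
      using eq[of _ p] pq by fastforce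
    ultimately show "\<exists>M\<subseteq>{..<d}. card M \<ge> 2 \<and> x \<in> LC n M" using M unfolding LC by blast
  next
    assume "\<exists>M\<subseteq>{..<d}. card M \<ge> 2 \<and> x \<in> LC n M"
    then obtain M r where M: "M \<subseteq> {..<d}" "card M \<ge> 2" "x \<in> cube_face d M"
      and r: "\<forall>i<d. poly (chebyshev_poly (n $ i)) (x $ i) = (-1) ^ r"
      unfolding LC by blast
    obtain p q where "p \<in> M" "q \<in> M" "p \<noteq> q"
      using M(2) by (meson card_2_iff' obtain_subset_with_card_n subset_iff)
    then obtain p q where pq: "p \<in> M" "q \<in> M" "p < q" by (metis nat_neq_iff)
    then have "q < d" "\<forall>i\<in>{p, q}. x $ i \<in> {-1<..<1}"
      "\<forall>i\<in>{p, q}. \<bar>poly (chebyshev_poly (n $ i)) (x $ i)\<bar> = 1"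
      using M r by (auto simp: cube_face_def power_abs)
    then show "singular_point n x"
      unfolding sing using pq by blast
  qed
qed

end
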